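(* Let $A\in\mathbb{R}^{m\times n}$ be a nonzero matrix, let $b\in\mathbb{R}^{m}$, and let $x_{\star}=A^{\dagger}b$ be the minimum Euclidean norm least squares solution of $\min_{x\in\mathbb{R}^n}\|b-Ax\|_2^2$. Let $A=U\Sigma V^T$ be a singular value decomposition with right singular vectors $v_1,\dots,v_n$ and singular values $\sigma_1(A)\ge\sigma_2(A)\ge\cdots$. Let $z_k$ be the $k$th approximation generated by the randomized extended Gauss--Seidel (REGS) method with (deterministic) initial vectors $x_0\in\mathbb{R}^n$ and $z_0\in\mathcal{R}(A^T)$. Then for every $k\ge 0$ and every $\ell\in\{1,\dots,\min\{m,n\}\}$, $$\mathbb{E}\big[\langle z_k-x_{\star},v_\ell\rangle\big]=\Big(1-\frac{\sigma_\ell^2(A)}{\|A\|_F^2}\Big)^k\langle z_0-x_{\star},v_\ell\rangle+\frac{k}{\|A\|_F^2}\Big(1-\frac{\sigma_\ell^2(A)}{\|A\|_F^2}\Big)^k\langle A^T(Ax_0-Ax_{\star}),v_\ell\rangle .$$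
   Context: Notation: $A^{(i)}$ is the $i$th row of $A$ (a row vector), $A_{(j)}$ is the $j$th column of $A$, $e_{(j)}$ is the $j$th column of the $n\times n$ identity matrix, $\|A\|_F$ is the Frobenius norm, $\mathcal{R}(\cdot)$ is the column space, $A^{\dagger}$ is the Moore--Penrose pseudoinverse, $\langle\cdot,\cdot\rangle$ is the Euclidean inner product, $\sigma_i(A)$ is the $i$th singular value of $A$. Singular value decomposition: $A=U\Sigma V^T$ with $U=[u_1,\dots,u_m]\in\mathbb{R}^{m\times m}$ and $V=[v_1,\dots,v_n]\in\mathbb{R}^{n\times n}$ orthogonal, and $\Sigma\in\mathbb{R}^{m\times n}$ diagonal with diagonal entries $\sigma_1(A)\ge\sigma_2(A)\ge\cdots$ in nonincreasing order; $u_i$, $v_i$ are the left and right singular vectors. REGS method: starting from $x_0\in\mathbb{R}^n$ and $z_0\in\mathcal{R}(A^T)$, for $k=1,2,\dots$: select $j\in\{1,\dots,n\}$ with probability $\|A_{(j)}\|_2^2/\|A\|_F^2$ and set $$x_k=x_{k-1}-\frac{A_{(j)}^T(Ax_{k-1}-b)}{\|A_{(j)}\|_2^2}\,e_{(j)};$$ then select $i\in\{1,\dots,m\}$ with probability $\|A^{(i)}\|_2^2/\|A\|_F^2$ and set $$z_k=z_{k-1}-\frac{A^{(i)}(z_{k-1}-x_k)}{\|A^{(i)}\|_2^2}\,(A^{(i)})^T .$$ All selections are mutually independent, and $\mathbb{E}$ is the expectation over all of them. *)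

theory Defs
  imports "HOL-Analysis.Analysis" "HOL-Probability.Probability"
begin

definition frob_norm :: "real ^ 'n ^ 'm \<Rightarrow> real" where
  "frob_norm A = sqrt (\<Sum>i\<in>UNIV. \<Sum>j\<in>UNIV. (A $ i $ j)\<^sup>2)"

definition col_space :: "real ^ 'n ^ 'm \<Rightarrow> (real ^ 'm) set" where
  "col_space A = span (columns A)"

text \<open>The four Penrose equations. Lemmas \<open>is_pinv_unique\<close> and \<open>is_svd_pinv\<close> below show
  that the definite description in \<open>pinv\<close> is justified for every matrix that has a singular value
  decomposition.\<close>

definition is_pinv :: "real ^ 'n ^ 'm \<Rightarrow> real ^ 'm ^ 'n \<Rightarrow> bool" where
  "is_pinv A X \<longleftrightarrow>
     A ** X ** A = A \<and> X ** A ** X = X \<and>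
     transpose (A ** X) = A ** X \<and> transpose (X ** A) = X ** A"

definition pinv :: "real ^ 'n ^ 'm \<Rightarrow> real ^ 'm ^ 'n" where
  "pinv A = (THE X. is_pinv A X)"

text \<open>The index types \<open>'m\<close> and \<open>'n\<close> carry no order, so "diagonal" and "\<open>i\<close>-th" are
  relative to enumerations \<open>p\<close> and \<open>q\<close> of the row and the column indices by \<open>1, 2, \<dots>\<close>: the
  \<open>i\<close>-th diagonal entry of \<open>D\<close> is \<open>D $ p i $ q i\<close>, and the \<open>i\<close>-th columns of \<open>U\<close> and \<open>V\<close> are
  \<open>column (p i) U\<close> and \<open>column (q i) V\<close>.\<close>

definition is_svd ::
  "(nat \<Rightarrow> 'm) \<Rightarrow> (nat \<Rightarrow> 'n) \<Rightarrow> real ^ 'n ^ 'm \<Rightarrow>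
   real ^ 'm ^ 'm \<Rightarrow> real ^ 'n ^ 'm \<Rightarrow> real ^ 'n ^ 'n \<Rightarrow> bool" where
  "is_svd p q A U D V \<longleftrightarrow>
     bij_betw p {1..CARD('m)} UNIV \<and> bij_betw q {1..CARD('n)} UNIV \<and>
     orthogonal_matrix U \<and> orthogonal_matrix V \<and>
     A = U ** D ** transpose V \<and>
     (\<forall>i\<in>{1..CARD('m)}. \<forall>j\<in>{1..CARD('n)}. i \<noteq> j \<longrightarrow> D $ p i $ q j = 0) \<and>
     (\<forall>i\<in>{1..min CARD('m) CARD('n)}. D $ p i $ q i \<ge> 0) \<and>
     (\<forall>i\<in>{1..min CARD('m) CARD('n)}. \<forall>j\<in>{1..min CARD('m) CARD('n)}.
        i \<le> j \<longrightarrow> D $ p j $ q j \<le> D $ p i $ q i)"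

text \<open>In \<open>regs_x\<close> and \<open>regs_z\<close>, \<open>J k\<close> and \<open>I k\<close> are the column and the row selected in step
  \<open>k \<ge> 1\<close>; the values at \<open>0\<close> are not used. A zero column or row has selection probability \<open>0\<close>.\<close>

primrec regs_x ::
  "real ^ 'n ^ 'm \<Rightarrow> real ^ 'm \<Rightarrow> real ^ 'n \<Rightarrow> (nat \<Rightarrow> 'n) \<Rightarrow> nat \<Rightarrow> real ^ 'n" where
  "regs_x A b x0 J 0 = x0"
| "regs_x A b x0 J (Suc k) =
     (let x = regs_x A b x0 J k; j = J (Suc k)
      in x - ((column j A \<bullet> (A *v x - b)) / (norm (column j A))\<^sup>2) *\<^sub>R axis j 1)"

primrec regs_z ::
  "real ^ 'n ^ 'm \<Rightarrow> real ^ 'm \<Rightarrow> real ^ 'n \<Rightarrow> real ^ 'n \<Rightarrow>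
   (nat \<Rightarrow> 'n) \<Rightarrow> (nat \<Rightarrow> 'm) \<Rightarrow> nat \<Rightarrow> real ^ 'n" where
  "regs_z A b x0 z0 J I 0 = z0"
| "regs_z A b x0 z0 J I (Suc k) =
     (let z = regs_z A b x0 z0 J I k; i = I (Suc k)
      in z - ((row i A \<bullet> (z - regs_x A b x0 J (Suc k))) / (norm (row i A))\<^sup>2) *\<^sub>R row i A)"

text \<open>\<open>Inl\<close> and \<open>Inr\<close> merely put all column and row selections into one family, so that
  \<open>indep_vars\<close> expresses their joint mutual independence.\<close>

definition regs_selection ::
  "real ^ 'n ^ 'm \<Rightarrow> 'w measure \<Rightarrow> (nat \<Rightarrow> 'w \<Rightarrow> 'n) \<Rightarrow> (nat \<Rightarrow> 'w \<Rightarrow> 'm) \<Rightarrow> bool" where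
  "regs_selection A M J I \<longleftrightarrow>
     prob_space M \<and>
     prob_space.indep_vars M (\<lambda>_. count_space UNIV)
       (case_sum (\<lambda>k \<omega>. Inl (J k \<omega>)) (\<lambda>k \<omega>. Inr (I k \<omega>))) ({1..} <+> {1..}) \<and>
     (\<forall>k\<ge>1. \<forall>j. measure M {\<omega> \<in> space M. J k \<omega> = j} =
        (norm (column j A))\<^sup>2 / (frob_norm A)\<^sup>2) \<and>
     (\<forall>k\<ge>1. \<forall>i. measure M {\<omega> \<in> space M. I k \<omega> = i} =
        (norm (row i A))\<^sup>2 / (frob_norm A)\<^sup>2)"

lemma is_pinv_unique:
  assumes X: "is_pinv A X" and Y: "is_pinv A Y"
  shows "X = Y"
proof -
  have "A ** X = transpose (A ** X)" using X by (simp add: is_pinv_def)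
  also have "\<dots> = transpose ((A ** Y) ** (A ** X))"
    using Y by (metis is_pinv_def matrix_mul_assoc)
  also have "\<dots> = (A ** X) ** (A ** Y)"
    using X Y by (metis is_pinv_def matrix_transpose_mul)
  also have "\<dots> = A ** Y" using X by (metis is_pinv_def matrix_mul_assoc)
  finally have 1: "A ** X = A ** Y" .
  have "X ** A = transpose (X ** A)" using X by (simp add: is_pinv_def)
  also have "\<dots> = transpose ((X ** A) ** (Y ** A))"
    using Y by (metis is_pinv_def matrix_mul_assoc)
  also have "\<dots> = (Y ** A) ** (X ** A)"
    using X Y by (metis is_pinv_def matrix_transpose_mul)
  also have "\<dots> = Y ** A" using X by (metis is_pinv_def matrix_mul_assoc)
  finally have 2: "X ** A = Y ** A" .
  have "X = X ** A ** X" using X by (simp add: is_pinv_def)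
  also have "\<dots> = Y ** A ** X" by (simp add: 2)
  also have "\<dots> = Y ** (A ** X)" by (simp add: matrix_mul_assoc)
  also have "\<dots> = Y ** A ** Y" by (simp add: 1 matrix_mul_assoc)
  also have "\<dots> = Y" using Y by (simp add: is_pinv_def)
  finally show ?thesis .
qed

lemma diag_pinv_aux:
  fixes D :: "real ^ 'n ^ 'm" and X :: "real ^ 'm ^ 'n"
  assumes row: "\<And>i j k. D $ i $ j \<noteq> 0 \<Longrightarrow> D $ i $ k \<noteq> 0 \<Longrightarrow> j = k"
    and col: "\<And>i j k. D $ i $ j \<noteq> 0 \<Longrightarrow> D $ k $ j \<noteq> 0 \<Longrightarrow> i = k"
    and X: "\<And>i j. X $ j $ i = inverse (D $ i $ j)"
  shows "D ** X ** D = D" "transpose (D ** X) = D ** X"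
proof -
  have off: "(D ** X) $ i $ k = 0" if "i \<noteq> k" for i k
  proof -
    have 0: "D $ i $ l * X $ l $ k = 0" for l
      using col[of i l k] that unfolding X by fastforce
    show ?thesis by (simp only: matrix_matrix_mult_def vec_lambda_beta 0 sum.neutral_const)
  qed
  have one: "(D ** X) $ i $ i = 1" if "D $ i $ j \<noteq> 0" for i j
  proof -
    have "(D ** X) $ i $ i = (\<Sum>l\<in>UNIV. if l = j then 1 else 0)"
      unfolding matrix_matrix_mult_def vec_lambda_beta
    proof (rule sum.cong[OF refl])
      fix l
      show "D $ i $ l * X $ l $ i = (if l = j then 1 else 0)"
        using row[OF that, of l] that unfolding X by (cases "D $ i $ l = 0") auto
    qed
    then show ?thesis by simp
  qed
  show "transpose (D ** X) = D ** X"
    unfolding vec_eq_iff transpose_def vec_lambda_beta by (metis off)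
  have "(D ** X ** D) $ i $ j = D $ i $ j" for i j
  proof -
    have "(D ** X ** D) $ i $ j = (\<Sum>k\<in>UNIV. (D ** X) $ i $ k * D $ k $ j)"
      by (simp add: matrix_matrix_mult_def)
    also have "\<dots> = (\<Sum>k\<in>UNIV. if k = i then D $ i $ j else 0)"
    proof (rule sum.cong[OF refl])
      fix k
      show "(D ** X) $ i $ k * D $ k $ j = (if k = i then D $ i $ j else 0)"
        using off[of i k] one[of i j] by (cases "D $ i $ j = 0") auto
    qed
    finally show ?thesis by simp
  qed
  then show "D ** X ** D = D" by (simp add: vec_eq_iff)
qed

lemma is_svd_is_pinv_ex:
  fixes A :: "real ^ 'n ^ 'm"
  assumes "is_svd p q A U D V"
  shows "\<exists>X. is_pinv A X"
proof -
  have D0: "a = b" if "D $ p a $ q b \<noteq> 0" "a \<in> {1..CARD('m)}" "b \<in> {1..CARD('n)}" for a b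
    using assms that unfolding is_svd_def by blast
  have p: "\<exists>a\<in>{1..CARD('m)}. i = p a" and q: "\<exists>b\<in>{1..CARD('n)}. j = q b" for i j
    using assms unfolding is_svd_def bij_betw_def by blast+
  have row: "j = k" if "D $ i $ j \<noteq> 0" "D $ i $ k \<noteq> 0" for i j k
    using that D0 p q by metis
  have col: "i = k" if "D $ i $ j \<noteq> 0" "D $ k $ j \<noteq> 0" for i j k
    using that D0 p q by metis
  define X where "X = (\<chi> j i. inverse (D $ i $ j))"
  have X: "X $ j $ i = inverse (D $ i $ j)" and X': "D $ i $ j = inverse (X $ j $ i)" for i j
    by (simp_all add: X_def)
  have nz: "X $ j $ i \<noteq> 0 \<longleftrightarrow> D $ i $ j \<noteq> 0" for i j
    by (simp add: X)
  note DX = diag_pinv_aux[of D X, OF row col X]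
  note XD = diag_pinv_aux[of X D, OF col[folded nz] row[folded nz] X']
  have UU: "transpose U ** U = mat 1" and VV: "transpose V ** V = mat 1"
    and A: "A = U ** D ** transpose V"
    using assms by (auto simp: is_svd_def orthogonal_matrix_def)
  let ?Y = "V ** X ** transpose U"
  have UU': "B ** transpose U ** U = B" for B :: "real ^ 'm ^ 'c"
    by (metis UU matrix_mul_assoc matrix_mul_rid)
  have VV': "B ** transpose V ** V = B" for B :: "real ^ 'n ^ 'c"
    by (metis VV matrix_mul_assoc matrix_mul_rid)
  have AY: "A ** ?Y = U ** (D ** X) ** transpose U"
    by (simp add: A matrix_mul_assoc VV')
  have YA: "?Y ** A = V ** (X ** D) ** transpose V"
    by (simp add: A matrix_mul_assoc UU')
  have "A ** ?Y ** A = U ** (D ** X ** D) ** transpose V"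
    by (simp add: AY) (simp add: A matrix_mul_assoc UU')
  moreover have "?Y ** A ** ?Y = V ** (X ** D ** X) ** transpose U"
    by (simp add: YA) (simp add: matrix_mul_assoc VV')
  moreover have "transpose (A ** ?Y) = A ** ?Y"
    unfolding AY by (simp add: matrix_transpose_mul DX(2)[unfolded matrix_transpose_mul] matrix_mul_assoc)
  moreover have "transpose (?Y ** A) = ?Y ** A"
    unfolding YA by (simp add: matrix_transpose_mul XD(2)[unfolded matrix_transpose_mul] matrix_mul_assoc)
  ultimately have "is_pinv A ?Y"
    unfolding is_pinv_def using DX(1) XD(1) A by simp
  then show ?thesis by blast
qed

lemma is_svd_pinv: "is_svd p q A U D V \<Longrightarrow> is_pinv A (pinv A)"
  unfolding pinv_def by (metis is_svd_is_pinv_ex is_pinv_unique theI)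

end

theory Submission
  imports Defs
begin

text \<open>
  A right singular vector $v$ is an eigenvector of \<open>transpose A ** A\<close> with eigenvalue
  $\sigma^2$, so the component along $v$ of the error of each sequence obeys a closed scalar
  recursion in expectation. Write $F$ for the squared Frobenius norm and $c = 1 - \sigma^2/F$.

  The selection probabilities cancel the denominators of the updates: averaging over the
  selected column turns a step for $x$ into
  $x - x_\star \mapsto (x - x_\star) - \frac1F A^T A (x - x_\star)$, where the normal equation
  allows $b$ to be replaced by $A x_\star$; averaging over the selected row turns a step for $z$
  into $z \mapsto z - \frac1F A^T A (z - x)$. Pairing with $v$ replaces $A^T A$ by $\sigma^2$
  (\<open>average_column_step\<close>, \<open>average_row_step\<close>). Since every selection is
  independent of all earlier ones, these one-step averages may be taken inside the full expectation
  (\<open>expectation_fresh_selection\<close>). Hence, with $X_k$ and $Z_k$ the expected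
  components along $v$ of the errors of $x_k$ and $z_k$,
  \[ X_{k+1} = c\,X_k, \qquad Z_{k+1} = c\,Z_k + \frac{\sigma^2}{F} X_{k+1}. \]
  The forcing term decays at the same rate $c$ as the homogeneous solution; this resonance
  produces the factor $k$ in
  $Z_k = c^k Z_0 + k \frac{\sigma^2}{F} c^k X_0$. Finally, $\sigma^2 X_0$ is the pairing of
  $A^T (A x_0 - A x_\star)$ with $v$.
\<close>

section \<open>Averaging over a fresh selection\<close>

text \<open>Finitely many random variables with values in a finite type take only finitely many joint
  values, and on a finite discrete product space every function is measurable and bounded.\<close>

lemma (in prob_space) integrable_finite_dependence:
  fixes S :: "'i \<Rightarrow> 'a \<Rightarrow> 'v::finite" and g :: "('i \<Rightarrow> 'v) \<Rightarrow> real"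
  assumes S: "\<And>h. h \<in> H \<Longrightarrow> S h \<in> measurable M (count_space UNIV)"
    and H: "finite H"
    and dep: "\<And>s s'. (\<And>h. h \<in> H \<Longrightarrow> s h = s' h) \<Longrightarrow> g s = g s'"
  shows "integrable M (\<lambda>\<omega>. g (\<lambda>h. S h \<omega>))"
proof -
  let ?E = "PiE H (\<lambda>_. UNIV :: 'v set)"
  have PiM: "PiM H (\<lambda>_. count_space UNIV) = count_space ?E"
    using H by (intro count_space_PiM_finite) auto
  have g: "g (\<lambda>h. S h \<omega>) = g (\<lambda>h\<in>H. S h \<omega>)" for \<omega>
    by (rule dep) simp
  have fin: "finite ?E"
    using H by (intro finite_PiE) auto
  have bound: "norm (g (\<lambda>h. S h \<omega>)) \<le> (\<Sum>s\<in>?E. norm (g s))" for \<omega>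
    unfolding g by (rule member_le_sum[OF _ _ fin]) auto
  have W: "(\<lambda>\<omega>. \<lambda>h\<in>H. S h \<omega>) \<in> measurable M (count_space ?E)"
    using measurable_restrict[of H S M "\<lambda>_. count_space UNIV", OF S] by (simp add: PiM)
  have "(\<lambda>\<omega>. g (\<lambda>h. S h \<omega>)) \<in> borel_measurable M"
    unfolding g by (rule measurable_compose[OF W]) simp
  then show ?thesis
    by (intro integrable_const_bound[where B="\<Sum>s\<in>?E. norm (g s)"]) (use bound in auto)
qed

text \<open>This is the conditioning step: \<open>g\<close> depends on the past, namely the variables in
  \<open>H\<close>, and on a feature \<open>f\<close> of one further variable. Splitting according to the value of
  that feature gives products of an indicator of the fresh variable and a function of the past,
  and independence factorises their expectations. The past is passed to \<open>g\<close> as the whole family,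
  with the dependence on \<open>H\<close> alone as a congruence property, so that recursively defined
  iterates can be used without truncating their sequences of selections. The map \<open>f\<close>
  serves to strip the injections from a family that mixes two kinds of selections.\<close>

lemma (in prob_space) expectation_fresh_selection:
  fixes S :: "'i \<Rightarrow> 'a \<Rightarrow> 'v::finite" and f :: "'v \<Rightarrow> 'u::finite"
    and g :: "'u \<Rightarrow> ('i \<Rightarrow> 'v) \<Rightarrow> real"
  assumes ind: "indep_vars (\<lambda>_. count_space UNIV) S K"
    and H: "finite H" "H \<subseteq> K" and i: "i \<in> K" "i \<notin> H"
    and dep: "\<And>u s s'. (\<And>h. h \<in> H \<Longrightarrow> s h = s' h) \<Longrightarrow> g u s = g u s'"
  shows "(\<integral>\<omega>. g (f (S i \<omega>)) (\<lambda>h. S h \<omega>) \<partial>M) =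
    (\<Sum>u\<in>UNIV. measure M {\<omega> \<in> space M. f (S i \<omega>) = u} * (\<integral>\<omega>. g u (\<lambda>h. S h \<omega>) \<partial>M))"
proof -
  have S: "S h \<in> measurable M (count_space UNIV)" if "h \<in> K" for h
    using ind that by (auto simp: indep_vars_def)
  have PiM: "PiM L (\<lambda>_. count_space UNIV) = count_space (PiE L (\<lambda>_. UNIV :: 'v set))"
    if "finite L" for L :: "'i set"
    using that by (intro count_space_PiM_finite) auto
  have Sf: "{\<omega> \<in> space M. f (S i \<omega>) = u} \<in> events" for u
    using measurable_sets[OF S[OF i(1)], of "f -` {u}"] by (simp add: vimage_def Int_def conj_commute)
  let ?ind = "\<lambda>u \<omega>. indicator {\<omega> \<in> space M. f (S i \<omega>) = u} \<omega> :: real"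
  have int_ind: "integrable M (?ind u)" for u
    by (intro integrable_real_indicator Sf) (simp add: less_top[symmetric])
  have int_g: "integrable M (\<lambda>\<omega>. g u (\<lambda>h. S h \<omega>))" for u
    using H S dep by (intro integrable_finite_dependence[where H=H]) (blast | simp)+
  have indep: "indep_var borel (\<lambda>\<omega>. of_bool (f (S i \<omega>) = u) :: real) borel (\<lambda>\<omega>. g u (\<lambda>h. S h \<omega>))" for u
  proof -
    have "indep_var (PiM {i} (\<lambda>_. count_space UNIV)) (\<lambda>\<omega>. \<lambda>h\<in>{i}. S h \<omega>)
        (PiM H (\<lambda>_. count_space UNIV)) (\<lambda>\<omega>. \<lambda>h\<in>H. S h \<omega>)"
      using H i by (intro indep_var_restrict[OF ind]) auto
    then have "indep_var borel ((\<lambda>s. of_bool (f (s i) = u) :: real) \<circ> (\<lambda>\<omega>. \<lambda>h\<in>{i}. S h \<omega>))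
        borel (g u \<circ> (\<lambda>\<omega>. \<lambda>h\<in>H. S h \<omega>))"
      by (rule indep_var_compose) (simp_all add: PiM H)
    moreover have "g u (\<lambda>h. S h \<omega>) = g u (\<lambda>h\<in>H. S h \<omega>)" for \<omega>
      by (rule dep) simp
    ultimately show ?thesis by (simp add: comp_def)
  qed
  have of_bool_ind: "of_bool (f (S i \<omega>) = u) = ?ind u \<omega>" if "\<omega> \<in> space M" for u \<omega>
    using that by (simp add: indicator_def)
  have int_bool: "integrable M (\<lambda>\<omega>. of_bool (f (S i \<omega>) = u) :: real)" for u
    using int_ind[of u] by (subst Bochner_Integration.integrable_cong[OF refl of_bool_ind])
  have exp_bool: "(\<integral>\<omega>. of_bool (f (S i \<omega>) = u) \<partial>M) = measure M {\<omega> \<in> space M. f (S i \<omega>) = u}" for u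
    by (subst Bochner_Integration.integral_cong[OF refl of_bool_ind]) (use Sf in auto)
  have "(\<integral>\<omega>. g (f (S i \<omega>)) (\<lambda>h. S h \<omega>) \<partial>M) =
      (\<integral>\<omega>. (\<Sum>u\<in>UNIV. of_bool (f (S i \<omega>) = u) * g u (\<lambda>h. S h \<omega>)) \<partial>M)"
    by (simp add: of_bool_def if_distrib[where f="\<lambda>x. x * _"] cong: if_cong)
  also have "\<dots> = (\<Sum>u\<in>UNIV. (\<integral>\<omega>. of_bool (f (S i \<omega>) = u) * g u (\<lambda>h. S h \<omega>) \<partial>M))"
    by (intro Bochner_Integration.integral_sum indep_var_integrable[OF indep int_bool int_g])
  also have "\<dots> = (\<Sum>u\<in>UNIV. measure M {\<omega> \<in> space M. f (S i \<omega>) = u} * (\<integral>\<omega>. g u (\<lambda>h. S h \<omega>) \<partial>M))"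
    by (simp only: indep_var_lebesgue_integral[OF indep int_bool int_g] exp_bool)
  finally show ?thesis .
qed

section \<open>Singular vectors and the normal equation\<close>

lemma is_svd_gram_right_singular_vector:
  fixes A :: "real ^ 'n ^ 'm"
  assumes svd: "is_svd p q A U D V" and l: "l \<in> {1..min CARD('m) CARD('n)}"
  shows "transpose A *v (A *v column (q l) V) = (D $ p l $ q l)\<^sup>2 *\<^sub>R column (q l) V"
proof -
  have D0: "a = c" if "D $ p a $ q c \<noteq> 0" "a \<in> {1..CARD('m)}" "c \<in> {1..CARD('n)}" for a c
    using svd that unfolding is_svd_def by blast
  have p: "\<exists>a\<in>{1..CARD('m)}. i = p a" and q: "\<exists>a\<in>{1..CARD('n)}. j = q a" for i j
    using svd unfolding is_svd_def bij_betw_def by blast+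
  have VV: "transpose V ** V = mat 1" and UU: "transpose U ** U = mat 1"
    and A: "A = U ** D ** transpose V"
    using svd by (auto simp: is_svd_def orthogonal_matrix_def)
  have De: "D *v axis (q l) 1 = (D $ p l $ q l) *\<^sub>R axis (p l) 1"
  proof -
    \<comment> \<open>Off the diagonal the entry vanishes even when \<open>i\<close> lies beyond the diagonal, that is,
      when its position exceeds \<open>CARD('n)\<close>.\<close>
    have "D $ i $ q l = D $ p l $ q l * axis (p l) 1 $ i" for i
    proof -
      obtain a where "a \<in> {1..CARD('m)}" "i = p a" using p by blast
      then show ?thesis using D0[of a l] l by (cases "a = l") (auto simp: axis_def)
    qed
    then show ?thesis
      unfolding vec_eq_iff matrix_vector_mult_basis column_def vec_lambda_beta
        vector_scaleR_component real_scaleR_def by blast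
  qed
  have Dte: "transpose D *v axis (p l) 1 = (D $ p l $ q l) *\<^sub>R axis (q l) 1"
  proof -
    have "D $ p l $ j = D $ p l $ q l * axis (q l) 1 $ j" for j
    proof -
      obtain a where "a \<in> {1..CARD('n)}" "j = q a" using q by blast
      then show ?thesis using D0[of l a] l by (cases "a = l") (auto simp: axis_def)
    qed
    then show ?thesis
      unfolding vec_eq_iff matrix_vector_mult_basis column_def transpose_def vec_lambda_beta
        vector_scaleR_component real_scaleR_def by blast
  qed
  have col: "column (q l) V = V *v axis (q l) 1"
    by (simp add: matrix_vector_mult_basis)
  have "transpose A *v (A *v column (q l) V) =
      V *v (transpose D *v ((transpose U ** U) *v (D *v ((transpose V ** V) *v axis (q l) 1))))"
    unfolding A col by (simp add: matrix_transpose_mul matrix_vector_mul_assoc matrix_mul_assoc)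
  also have "\<dots> = (D $ p l $ q l)\<^sup>2 *\<^sub>R column (q l) V"
    by (simp add: UU VV De Dte col matrix_vector_mult_scaleR power2_eq_square del: transpose_matrix_vector)
  finally show ?thesis .
qed

lemma is_pinv_normal_equation:
  fixes A :: "real ^ 'n ^ 'm"
  assumes "is_pinv A X"
  shows "transpose A *v (A *v (X *v b)) = transpose A *v b"
proof -
  have "transpose A = transpose (A ** X ** A)"
    using assms by (simp add: is_pinv_def)
  also have "\<dots> = transpose A ** (A ** X)"
    using assms by (metis is_pinv_def matrix_transpose_mul)
  finally show ?thesis
    by (metis matrix_vector_mul_assoc)
qed

section \<open>Frobenius norm and one-step averages\<close>

lemma inner_transpose_left: "(transpose A *v y) \<bullet> x = y \<bullet> (A *v x)"
  for A :: "real ^ 'n ^ 'm"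
  by (simp add: dot_lmul_matrix)

lemma inner_gram: "(A *v x) \<bullet> (A *v y) = x \<bullet> (transpose A *v (A *v y))"
  for A :: "real ^ 'n ^ 'm"
  by (metis inner_transpose_left inner_commute)

lemma sum_norm_columns: "(\<Sum>j\<in>UNIV. (norm (column j A))\<^sup>2) = (frob_norm A)\<^sup>2"
  for A :: "real ^ 'n ^ 'm"
proof -
  have "(\<Sum>j\<in>UNIV. (norm (column j A))\<^sup>2) = (\<Sum>j\<in>UNIV. \<Sum>i\<in>UNIV. (A $ i $ j)\<^sup>2)"
    unfolding power2_norm_eq_inner inner_vec_def column_def by (simp add: power2_eq_square)
  also have "\<dots> = (frob_norm A)\<^sup>2"
    unfolding frob_norm_def by (subst sum.swap) (simp add: sum_nonneg)
  finally show ?thesis .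
qed

lemma sum_norm_rows: "(\<Sum>i\<in>UNIV. (norm (row i A))\<^sup>2) = (frob_norm A)\<^sup>2"
  for A :: "real ^ 'n ^ 'm"
  unfolding power2_norm_eq_inner inner_vec_def row_def frob_norm_def
  by (simp add: sum_nonneg flip: power2_eq_square)

lemma frob_norm_pos: "A \<noteq> 0 \<Longrightarrow> 0 < (frob_norm A)\<^sup>2"
proof -
  assume "A \<noteq> 0"
  then obtain i j where "A $ i $ j \<noteq> 0"
    by (auto simp: vec_eq_iff)
  then have "column j A \<noteq> 0"
    by (auto simp: vec_eq_iff column_def)
  then have "0 < (\<Sum>j\<in>UNIV. (norm (column j A))\<^sup>2)"
    by (intro sum_pos2[of _ j]) auto
  then show ?thesis by (simp add: sum_norm_columns)
qed

text \<open>The weight of column \<open>j\<close> cancels the denominator of the update, which leaves the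
  \<open>j\<close>-th component of \<open>transpose A *v (A *v x - b)\<close>. A zero column causes no exception:
  its weight and its numerator both vanish.\<close>

lemma average_column_step:
  fixes A :: "real ^ 'n ^ 'm"
  assumes A: "A \<noteq> 0" and normal: "transpose A *v (A *v x_star) = transpose A *v b"
    and eig: "transpose A *v (A *v v) = \<sigma>2 *\<^sub>R v"
  shows "(\<Sum>j\<in>UNIV. (norm (column j A))\<^sup>2 / (frob_norm A)\<^sup>2 *
      ((x - ((column j A \<bullet> (A *v x - b)) / (norm (column j A))\<^sup>2) *\<^sub>R axis j 1 - x_star) \<bullet> v)) =
    (1 - \<sigma>2 / (frob_norm A)\<^sup>2) * ((x - x_star) \<bullet> v)" (is "(\<Sum>j\<in>UNIV. ?w j) = _")
proof -
  define F where "F = (frob_norm A)\<^sup>2"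
  have F: "F > 0" using frob_norm_pos[OF A] by (simp add: F_def)
  have w: "?w j = (norm (column j A))\<^sup>2 / F * ((x - x_star) \<bullet> v)
      - (column j A \<bullet> (A *v x - b)) * v $ j / F" for j
  proof (cases "column j A = 0")
    case False
    then have "norm (column j A) \<noteq> 0" by simp
    then show ?thesis
      unfolding inner_diff_left inner_scaleR_left F_def[symmetric]
      using F by (simp add: inner_axis' field_simps power2_eq_square)
  qed simp
  have col: "column j A \<bullet> y = (transpose A *v y) $ j" for j y
    by (simp add: matrix_vector_mul_component transpose_def column_def)
  have "(\<Sum>j\<in>UNIV. (column j A \<bullet> (A *v x - b)) * v $ j) = (transpose A *v (A *v x - b)) \<bullet> v"
    unfolding col by (simp only: inner_vec_def inner_real_def)
  also have "transpose A *v (A *v x - b) = transpose A *v (A *v (x - x_star))"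
    by (simp add: matrix_vector_mult_diff_distrib normal del: transpose_matrix_vector)
  also have "\<dots> \<bullet> v = (x - x_star) \<bullet> (transpose A *v (A *v v))"
    by (simp only: inner_transpose_left inner_gram)
  also have "\<dots> = \<sigma>2 * ((x - x_star) \<bullet> v)"
    by (simp only: eig inner_scaleR_right)
  finally have s: "(\<Sum>j\<in>UNIV. (column j A \<bullet> (A *v x - b)) * v $ j) = \<sigma>2 * ((x - x_star) \<bullet> v)" .
  have "(\<Sum>j\<in>UNIV. ?w j) = (\<Sum>j\<in>UNIV. (norm (column j A))\<^sup>2) / F * ((x - x_star) \<bullet> v)
      - (\<Sum>j\<in>UNIV. (column j A \<bullet> (A *v x - b)) * v $ j) / F"
    by (simp only: w sum_subtractf sum_distrib_right sum_divide_distrib)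
  also have "\<dots> = (1 - \<sigma>2 / F) * ((x - x_star) \<bullet> v)"
    unfolding s sum_norm_columns F_def[symmetric] using F by (simp add: left_diff_distrib)
  finally show ?thesis by (simp only: F_def)
qed

text \<open>The same cancellation for rows: the rank-one terms of the rows add up to
  \<open>transpose A ** A\<close>, here in the form of an inner product of images under \<open>A\<close>. The
  target \<open>x\<close> is the current iterate of the other sequence, not \<open>x_star\<close>, whence the
  forcing term.\<close>

lemma average_row_step:
  fixes A :: "real ^ 'n ^ 'm"
  assumes A: "A \<noteq> 0" and eig: "transpose A *v (A *v v) = \<sigma>2 *\<^sub>R v"
  shows "(\<Sum>i\<in>UNIV. (norm (row i A))\<^sup>2 / (frob_norm A)\<^sup>2 *
      ((z - ((row i A \<bullet> (z - x)) / (norm (row i A))\<^sup>2) *\<^sub>R row i A - x_star) \<bullet> v)) =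
    (1 - \<sigma>2 / (frob_norm A)\<^sup>2) * ((z - x_star) \<bullet> v) + \<sigma>2 / (frob_norm A)\<^sup>2 * ((x - x_star) \<bullet> v)"
    (is "(\<Sum>i\<in>UNIV. ?w i) = _")
proof -
  define F where "F = (frob_norm A)\<^sup>2"
  have F: "F > 0" using frob_norm_pos[OF A] by (simp add: F_def)
  have w: "?w i = (norm (row i A))\<^sup>2 / F * ((z - x_star) \<bullet> v)
      - (row i A \<bullet> (z - x)) * (row i A \<bullet> v) / F" for i
  proof (cases "row i A = 0")
    case False
    then have "norm (row i A) \<noteq> 0" by simp
    then show ?thesis
      unfolding inner_diff_left inner_scaleR_left F_def[symmetric]
      using F by (simp add: field_simps power2_eq_square)
  qed simp
  have row: "row i A \<bullet> y = (A *v y) $ i" for i y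
    by (simp add: matrix_vector_mul_component row_def)
  have "(\<Sum>i\<in>UNIV. (row i A \<bullet> (z - x)) * (row i A \<bullet> v)) = (A *v (z - x)) \<bullet> (A *v v)"
    unfolding row by (simp only: inner_vec_def inner_real_def)
  also have "\<dots> = (z - x) \<bullet> (transpose A *v (A *v v))"
    by (simp only: inner_transpose_left inner_gram)
  also have "\<dots> = \<sigma>2 * ((z - x) \<bullet> v)"
    by (simp only: eig inner_scaleR_right)
  finally have s: "(\<Sum>i\<in>UNIV. (row i A \<bullet> (z - x)) * (row i A \<bullet> v)) = \<sigma>2 * ((z - x) \<bullet> v)" .
  have "(\<Sum>i\<in>UNIV. ?w i) = (\<Sum>i\<in>UNIV. (norm (row i A))\<^sup>2) / F * ((z - x_star) \<bullet> v)
      - (\<Sum>i\<in>UNIV. (row i A \<bullet> (z - x)) * (row i A \<bullet> v)) / F"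
    by (simp only: w sum_subtractf sum_distrib_right sum_divide_distrib)
  also have "\<dots> = (1 - \<sigma>2 / F) * ((z - x_star) \<bullet> v) + \<sigma>2 / F * ((x - x_star) \<bullet> v)"
    unfolding s sum_norm_rows F_def[symmetric] inner_diff_left using F by (simp add: field_simps)
  finally show ?thesis by (simp only: F_def)
qed

section \<open>The expected error of the iterates\<close>

lemma regs_x_cong:
  "(\<And>t. t \<in> {1..k} \<Longrightarrow> J t = J' t) \<Longrightarrow> regs_x A b x0 J k = regs_x A b x0 J' k"
  by (induction k) (auto simp: Let_def)

lemma regs_z_cong:
  assumes "\<And>t. t \<in> {1..k} \<Longrightarrow> J t = J' t" "\<And>t. t \<in> {1..k} \<Longrightarrow> I t = I' t"
  shows "regs_z A b x0 z0 J I k = regs_z A b x0 z0 J' I' k"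
  using assms
proof (induction k)
  case (Suc k)
  have "regs_x A b x0 J (Suc k) = regs_x A b x0 J' (Suc k)"
    using Suc.prems(1) by (rule regs_x_cong)
  then show ?case
    using Suc by (simp add: Let_def del: regs_x.simps)
qed simp

theorem theorem6:
  fixes A :: "real ^ 'n ^ 'm" and b :: "real ^ 'm"
    and x0 z0 x_star :: "real ^ 'n"
    and U :: "real ^ 'm ^ 'm" and D :: "real ^ 'n ^ 'm" and V :: "real ^ 'n ^ 'n"
    and p :: "nat \<Rightarrow> 'm" and q :: "nat \<Rightarrow> 'n"
    and M :: "'w measure" and J :: "nat \<Rightarrow> 'w \<Rightarrow> 'n" and I :: "nat \<Rightarrow> 'w \<Rightarrow> 'm"
    and k l :: nat
  assumes "A \<noteq> 0"
    and "x_star = pinv A *v b"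
    and "is_svd p q A U D V"
    and "z0 \<in> col_space (transpose A)"
    and "regs_selection A M J I"
    and "l \<in> {1..min CARD('m) CARD('n)}"
  shows "(\<integral>\<omega>. (regs_z A b x0 z0 (\<lambda>t. J t \<omega>) (\<lambda>t. I t \<omega>) k - x_star) \<bullet> column (q l) V \<partial>M) =
      (1 - (D $ p l $ q l)\<^sup>2 / (frob_norm A)\<^sup>2) ^ k * ((z0 - x_star) \<bullet> column (q l) V)
      + real k / (frob_norm A)\<^sup>2 * (1 - (D $ p l $ q l)\<^sup>2 / (frob_norm A)\<^sup>2) ^ k
        * ((transpose A *v (A *v x0 - A *v x_star)) \<bullet> column (q l) V)"
proof -
  let ?S = "case_sum (\<lambda>k \<omega>. Inl (J k \<omega>)) (\<lambda>k \<omega>. Inr (I k \<omega>)) :: nat + nat \<Rightarrow> 'w \<Rightarrow> 'n + 'm"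
  let ?K = "{1..} <+> {1..} :: (nat + nat) set"
  interpret prob_space M
    using assms(5) by (simp add: regs_selection_def)
  have ind: "indep_vars (\<lambda>_. count_space UNIV) ?S ?K"
    and PJ: "\<And>k j. k \<ge> 1 \<Longrightarrow> measure M {\<omega> \<in> space M. J k \<omega> = j} = (norm (column j A))\<^sup>2 / (frob_norm A)\<^sup>2"
    and PI: "\<And>k i. k \<ge> 1 \<Longrightarrow> measure M {\<omega> \<in> space M. I k \<omega> = i} = (norm (row i A))\<^sup>2 / (frob_norm A)\<^sup>2"
    using assms(5) by (auto simp: regs_selection_def)
  define v where "v = column (q l) V"
  define \<sigma>2 where "\<sigma>2 = (D $ p l $ q l)\<^sup>2"
  define F where "F = (frob_norm A)\<^sup>2"
  define c where "c = 1 - \<sigma>2 / F"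
  have F: "F > 0" using frob_norm_pos[OF assms(1)] by (simp add: F_def)
  have eig: "transpose A *v (A *v v) = \<sigma>2 *\<^sub>R v"
    unfolding v_def \<sigma>2_def using assms(3,6) by (rule is_svd_gram_right_singular_vector)
  have normal: "transpose A *v (A *v x_star) = transpose A *v b"
    unfolding assms(2) using is_svd_pinv[OF assms(3)] by (rule is_pinv_normal_equation)
  \<comment> \<open>The iterates as functions of one combined family of selections, the form in which joint
    independence is given.\<close>
  define X where "X k s = regs_x A b x0 (\<lambda>t. projl (s (Inl t))) k"
    for k and s :: "nat + nat \<Rightarrow> 'n + 'm"
  define Z where "Z k s = regs_z A b x0 z0 (\<lambda>t. projl (s (Inl t))) (\<lambda>t. projr (s (Inr t))) k"
    for k and s :: "nat + nat \<Rightarrow> 'n + 'm"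
  \<comment> \<open>The first \<open>a\<close> column selections and the first \<open>r\<close> row selections.\<close>
  let ?H = "\<lambda>a r. {1..a} <+> {1..r} :: (nat + nat) set"
  have H: "finite (?H a r)" "?H a r \<subseteq> ?K" for a r by auto
  have X_cong: "X a s = X a s'" if "\<And>h. h \<in> ?H a r \<Longrightarrow> s h = s' h" for a r s s'
    unfolding X_def by (intro regs_x_cong arg_cong[where f=projl] that) auto
  have Z_cong: "Z a s = Z a s'" if "\<And>h. h \<in> ?H r a \<Longrightarrow> s h = s' h" "a \<le> r" for a r s s'
    unfolding Z_def using that(2)
    by (intro regs_z_cong arg_cong[where f=projl] arg_cong[where f=projr] that(1)) auto
  have S: "?S h \<in> measurable M (count_space UNIV)" if "h \<in> ?K" for h
    using ind that by (auto simp: indep_vars_def)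
  have integrable: "integrable M (\<lambda>\<omega>. \<phi> (X a (\<lambda>h. ?S h \<omega>)) (Z r (\<lambda>h. ?S h \<omega>)))"
    for \<phi> :: "real ^ 'n \<Rightarrow> real ^ 'n \<Rightarrow> real" and a r
  proof (rule integrable_finite_dependence[where H="?H (max a r) r" and g="\<lambda>s. \<phi> (X a s) (Z r s)"])
    fix s s' :: "nat + nat \<Rightarrow> 'n + 'm"
    assume eq: "\<And>h. h \<in> ?H (max a r) r \<Longrightarrow> s h = s' h"
    have "X a s = X a s'"
      by (rule X_cong[of _ r], rule eq) auto
    moreover have "Z r s = Z r s'"
      by (rule Z_cong[of "max a r"], rule eq) auto
    ultimately show "\<phi> (X a s) (Z r s) = \<phi> (X a s') (Z r s')" by simp
  qed (use S H in blast)+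
  have EX: "(\<integral>\<omega>. (X k (\<lambda>h. ?S h \<omega>) - x_star) \<bullet> v \<partial>M) = c ^ k * ((x0 - x_star) \<bullet> v)" for k
  proof (induction k)
    case 0
    then show ?case by (simp add: X_def prob_space)
  next
    case (Suc k)
    define G where "G j s = (X k s - ((column j A \<bullet> (A *v X k s - b)) / (norm (column j A))\<^sup>2) *\<^sub>R axis j 1
      - x_star) \<bullet> v" for j s
    have integrable_G: "integrable M (\<lambda>\<omega>. G j (\<lambda>h. ?S h \<omega>))" for j
      unfolding G_def by (rule integrable[of "\<lambda>x z. (x - ((column j A \<bullet> (A *v x - b)) / (norm (column j A))\<^sup>2)
        *\<^sub>R axis j 1 - x_star) \<bullet> v" k k])
    have "(\<integral>\<omega>. (X (Suc k) (\<lambda>h. ?S h \<omega>) - x_star) \<bullet> v \<partial>M) =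
        (\<integral>\<omega>. G (projl (?S (Inl (Suc k)) \<omega>)) (\<lambda>h. ?S h \<omega>) \<partial>M)"
      by (simp add: G_def X_def Let_def)
    also have "\<dots> = (\<Sum>j\<in>UNIV. measure M {\<omega> \<in> space M. projl (?S (Inl (Suc k)) \<omega>) = j} *
        (\<integral>\<omega>. G j (\<lambda>h. ?S h \<omega>) \<partial>M))"
    proof (rule expectation_fresh_selection[OF ind H(1,2)[of k 0]])
      show "G j s = G j s'" if "\<And>h. h \<in> ?H k 0 \<Longrightarrow> s h = s' h" for j s s'
      proof -
        have "X k s = X k s'" using that by (rule X_cong)
        then show ?thesis by (simp add: G_def)
      qed
    qed auto
    also have "\<dots> = (\<Sum>j\<in>UNIV. (norm (column j A))\<^sup>2 / (frob_norm A)\<^sup>2 * (\<integral>\<omega>. G j (\<lambda>h. ?S h \<omega>) \<partial>M))"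
      by (simp add: PJ)
    also have "\<dots> = (\<integral>\<omega>. (\<Sum>j\<in>UNIV. (norm (column j A))\<^sup>2 / (frob_norm A)\<^sup>2 * G j (\<lambda>h. ?S h \<omega>)) \<partial>M)"
      by (simp add: integrable_G Bochner_Integration.integral_sum del: times_divide_eq_left)
    also have "\<dots> = (\<integral>\<omega>. c * ((X k (\<lambda>h. ?S h \<omega>) - x_star) \<bullet> v) \<partial>M)"
      unfolding G_def average_column_step[OF assms(1) normal eig] c_def F_def ..
    also have "\<dots> = c ^ Suc k * ((x0 - x_star) \<bullet> v)"
      by (simp add: Suc.IH)
    finally show ?case .
  qed
  have EZ: "(\<integral>\<omega>. (Z k (\<lambda>h. ?S h \<omega>) - x_star) \<bullet> v \<partial>M) =
      c ^ k * ((z0 - x_star) \<bullet> v) + real k * \<sigma>2 / F * c ^ k * ((x0 - x_star) \<bullet> v)"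
  proof (induction k)
    case 0
    then show ?case by (simp add: Z_def prob_space)
  next
    case (Suc k)
    define G where "G i s = (Z k s - ((row i A \<bullet> (Z k s - X (Suc k) s)) / (norm (row i A))\<^sup>2) *\<^sub>R row i A
      - x_star) \<bullet> v" for i s
    have integrable_G: "integrable M (\<lambda>\<omega>. G i (\<lambda>h. ?S h \<omega>))" for i
      unfolding G_def by (rule integrable[of "\<lambda>x z. (z - ((row i A \<bullet> (z - x)) / (norm (row i A))\<^sup>2)
        *\<^sub>R row i A - x_star) \<bullet> v" "Suc k" k])
    have "(\<integral>\<omega>. (Z (Suc k) (\<lambda>h. ?S h \<omega>) - x_star) \<bullet> v \<partial>M) =
        (\<integral>\<omega>. G (projr (?S (Inr (Suc k)) \<omega>)) (\<lambda>h. ?S h \<omega>) \<partial>M)"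
      by (simp add: G_def X_def Z_def Let_def del: regs_x.simps)
    also have "\<dots> = (\<Sum>i\<in>UNIV. measure M {\<omega> \<in> space M. projr (?S (Inr (Suc k)) \<omega>) = i} *
        (\<integral>\<omega>. G i (\<lambda>h. ?S h \<omega>) \<partial>M))"
      \<comment> \<open>The row step already uses the new \<open>x\<close>, so its past contains one more column than rows.\<close>
    proof (rule expectation_fresh_selection[OF ind H(1,2)[of "Suc k" k]])
      show "G i s = G i s'" if "\<And>h. h \<in> ?H (Suc k) k \<Longrightarrow> s h = s' h" for i s s'
      proof -
        have "X (Suc k) s = X (Suc k) s'" using that by (rule X_cong)
        moreover have "Z k s = Z k s'" using that by (rule Z_cong) auto
        ultimately show ?thesis by (simp add: G_def)
      qed
    qed auto
    also have "\<dots> = (\<Sum>i\<in>UNIV. (norm (row i A))\<^sup>2 / (frob_norm A)\<^sup>2 * (\<integral>\<omega>. G i (\<lambda>h. ?S h \<omega>) \<partial>M))"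
      by (simp add: PI)
    also have "\<dots> = (\<integral>\<omega>. (\<Sum>i\<in>UNIV. (norm (row i A))\<^sup>2 / (frob_norm A)\<^sup>2 * G i (\<lambda>h. ?S h \<omega>)) \<partial>M)"
      by (simp add: integrable_G Bochner_Integration.integral_sum del: times_divide_eq_left)
    also have "\<dots> = (\<integral>\<omega>. c * ((Z k (\<lambda>h. ?S h \<omega>) - x_star) \<bullet> v)
        + \<sigma>2 / F * ((X (Suc k) (\<lambda>h. ?S h \<omega>) - x_star) \<bullet> v) \<partial>M)"
      unfolding G_def average_row_step[OF assms(1) eig] c_def F_def ..
    also have "\<dots> = c * (\<integral>\<omega>. (Z k (\<lambda>h. ?S h \<omega>) - x_star) \<bullet> v \<partial>M)
        + \<sigma>2 / F * (\<integral>\<omega>. (X (Suc k) (\<lambda>h. ?S h \<omega>) - x_star) \<bullet> v \<partial>M)"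
      using integrable[of "\<lambda>x z. (z - x_star) \<bullet> v" k k] integrable[of "\<lambda>x z. (x - x_star) \<bullet> v" "Suc k" k]
      by (subst Bochner_Integration.integral_add) (simp_all del: times_divide_eq_left)
    also have "\<dots> = c ^ Suc k * ((z0 - x_star) \<bullet> v)
        + real (Suc k) * \<sigma>2 / F * c ^ Suc k * ((x0 - x_star) \<bullet> v)"
      unfolding Suc.IH EX using F by (simp add: field_simps)
    finally show ?case .
  qed
  have "(transpose A *v (A *v x0 - A *v x_star)) \<bullet> v = (x0 - x_star) \<bullet> (transpose A *v (A *v v))"
    by (simp only: inner_transpose_left inner_gram flip: matrix_vector_mult_diff_distrib)
  also have "\<dots> = \<sigma>2 * ((x0 - x_star) \<bullet> v)"
    by (simp only: eig inner_scaleR_right)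
  finally show ?thesis
    using EZ by (simp add: Z_def flip: v_def \<sigma>2_def F_def c_def)
qed

end
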